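(* Let $U,X,Y$ be types, let $S,S'$ be monotonic predicate transformers with input type $U\times X$ and output type $U\times Y$, and let $init$ be a predicate on $U$. Then: 1. $S\sqsubseteq S'$ implies $\mathrm{AddDelay}(S)\sqsubseteq \mathrm{AddDelay}(S')$. 2. $S\sqsubseteq S'$ implies $\mathrm{DelayFeedback}(init,S)\sqsubseteq \mathrm{DelayFeedback}(init,S')$.
   Context: Predicates on $X$ are functions $X\to\mathrm{Bool}$, ordered by pointwise implication $\le$. A monotonic transformer with input type $X$ and output type $Y$ is a monotone function $S$ from predicates on $Y$ to predicates on $X$. It is called a predicate transformer for ordinary types, and a property transformer when the types are types of traces $X^\omega=(\mathbb N\to X)$ (a tuple of traces is identified with the trace of tuples). Refinement: $S\sqsubseteq T$ iff $S(q)\le T(q)$ for all $q$. Serial composition: $(S;T)(q)=S(T(q))$. $\mathrm{Skip}(q)=q$. For a relation $r$ between $X$ and $Y$, the demonic update $[r]$ is $[r](q)(x)=(\forall y: r(x,y)\Rightarrow q(y))$; $[x\leadsto y\mid E]$ denotes $[r]$ with $r(x,y)\Leftrightarrow E$, and $[x\leadsto e]$ denotes $[x\leadsto y\mid y=e]$. Product: $(S\times T)(q)(s,s')$ iff there are predicates $p,r$ such that $(\forall a,b: p(a)\wedge r(b)\Rightarrow q(a,b))$ and $S(p)(s)$ and $T(r)(s')$. Fusion of a family $(S_i)_{i\in I}$ with common input and output types: $\mathrm{Fusion}((S_i)_i)(q)(s)$ iff there are predicates $(p_i)_{i\in I}$ with $\bigwedge_i p_i\le q$ and $S_i(p_i)(s)$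 for all $i$. For a trace $\mathbf x$: $\mathbf x_i=\mathbf x(i)$, $\mathbf x^i$ is the trace $j\mapsto\mathbf x_{i+j}$, and $z\cdot\mathbf w$ is $\mathbf w$ with $z$ prepended. For a property transformer $S$ with input and output type $Z^\omega$ and $n\in\mathbb N$: $\mathrm{SkipNext}(S)=[\mathbf x\leadsto(\mathbf x_0,\mathbf x^1)];(\mathrm{Skip}\times S);[(z,\mathbf w)\leadsto z\cdot\mathbf w]$; $\mathrm{SkipTop}(n)=[\mathbf x\leadsto\mathbf y\mid\forall i<n:\mathbf x_i=\mathbf y_i]$; $\mathrm{Iterate}(F,S,n)=S;F(S);\dots;F^{n-1}(S)$ (equal to $\mathrm{Skip}$ for $n=0$), for a mapping $F$ on monotonic property transformers; $\mathrm{IterateNextOmega}(S)=\mathrm{Fusion}\big((\mathrm{Iterate}(\mathrm{SkipNext},S,n);\mathrm{SkipTop}(n))_{n\in\mathbb N}\big)$. For a predicate transformer $S$ with input type $U\times X$ (current state, input) and output type $U\times Y$ (next state, output), $\mathrm{AddDelay}(S)$ is the property transformer with input and output type $U^\omega\times X^\omega\times Y^\omega$: $\mathrm{AddDelay}(S)=[(\mathbf u,\mathbf x,\mathbf y)\leadsto((\mathbf u_0,\mathbf x_0),(\mathbf u_0,\mathbf x))];(S\times\mathrm{Skip});[((a,b),(u,\mathbf x))\leadsto(\mathbf u',\mathbf x',\mathbf y')\mid \mathbf u'_0=u\wedge\mathbf u'_1=a\wedge\mathbf y'_0=b\wedge\mathbf x'=\mathbf x]$. For a predicate $init$ on $U$: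 $\mathrm{DelayFeedback}(init,S)=[\mathbf x\leadsto(\mathbf u,\mathbf x,\mathbf y)\mid init(\mathbf u_0)];\mathrm{IterateNextOmega}(\mathrm{AddDelay}(S));[(\mathbf u,\mathbf x,\mathbf y)\leadsto\mathbf y]$. *)

theory Defs
  imports Main
begin

type_synonym 'a pred = "'a \<Rightarrow> bool"

text \<open>Transformers with input type \<open>'a\<close> and output type \<open>'b\<close>; note the contravariance.
  Monotonicity is not built into the type and is required separately as \<open>mono S\<close>.\<close>
type_synonym ('a, 'b) trans = "'b pred \<Rightarrow> 'a pred"

type_synonym 'a trace = "nat \<Rightarrow> 'a"

definition refines :: "('a, 'b) trans \<Rightarrow> ('a, 'b) trans \<Rightarrow> bool" (infix "\<sqsubseteq>" 50)
  where "S \<sqsubseteq> T \<longleftrightarrow> (\<forall>q. S q \<le> T q)"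

definition serial :: "('a, 'b) trans \<Rightarrow> ('b, 'c) trans \<Rightarrow> ('a, 'c) trans" (infixl ";;" 60)
  where "S ;; T = (\<lambda>q. S (T q))"

definition Skip :: "('a, 'a) trans"
  where "Skip q = q"

definition demonic :: "('a \<Rightarrow> 'b \<Rightarrow> bool) \<Rightarrow> ('a, 'b) trans"
  where "demonic r q x \<longleftrightarrow> (\<forall>y. r x y \<longrightarrow> q y)"

definition assign :: "('a \<Rightarrow> 'b) \<Rightarrow> ('a, 'b) trans"
  where "assign e = demonic (\<lambda>x y. y = e x)"

definition Prod :: "('a, 'b) trans \<Rightarrow> ('c, 'd) trans \<Rightarrow> ('a \<times> 'c, 'b \<times> 'd) trans"
    (infixr "\<otimes>" 70)
  where "(S \<otimes> T) q = (\<lambda>(s, s'). \<exists>p r. (\<forall>a b. p a \<and> r b \<longrightarrow> q (a, b)) \<and> S p s \<and> T r s')"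

definition Fusion :: "('i \<Rightarrow> ('a, 'b) trans) \<Rightarrow> ('a, 'b) trans"
  where "Fusion S q s \<longleftrightarrow> (\<exists>p. (INF i. p i) \<le> q \<and> (\<forall>i. S i (p i) s))"

definition suffix :: "'a trace \<Rightarrow> nat \<Rightarrow> 'a trace"
  where "suffix x i = (\<lambda>j. x (i + j))"

definition prepend :: "'a \<Rightarrow> 'a trace \<Rightarrow> 'a trace"
  where "prepend z w = case_nat z w"

definition SkipNext :: "('z trace, 'z trace) trans \<Rightarrow> ('z trace, 'z trace) trans"
  where "SkipNext S =
    assign (\<lambda>x. (x 0, suffix x 1)) ;; (Skip \<otimes> S) ;; assign (\<lambda>(z, w). prepend z w)"

definition SkipTop :: "nat \<Rightarrow> ('z trace, 'z trace) trans"
  where "SkipTop n = demonic (\<lambda>x y. \<forall>i<n. x i = y i)"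

primrec Iterate ::
  "(('a, 'a) trans \<Rightarrow> ('a, 'a) trans) \<Rightarrow> ('a, 'a) trans \<Rightarrow> nat \<Rightarrow> ('a, 'a) trans"
  where
    "Iterate F S 0 = Skip"
  | "Iterate F S (Suc n) = Iterate F S n ;; (F ^^ n) S"

definition IterateNextOmega :: "('z trace, 'z trace) trans \<Rightarrow> ('z trace, 'z trace) trans"
  where "IterateNextOmega S = Fusion (\<lambda>n. Iterate SkipNext S n ;; SkipTop n)"

text \<open>The identification of a trace of triples with a triple of traces. The transformers below act
  on traces of triples, as \<open>IterateNextOmega\<close> requires; their relations are written in terms of
  the component traces.\<close>
definition unzip3 :: "('u \<times> 'x \<times> 'y) trace \<Rightarrow> 'u trace \<times> 'x trace \<times> 'y trace"
  where "unzip3 t = (\<lambda>i. fst (t i), \<lambda>i. fst (snd (t i)), \<lambda>i. snd (snd (t i)))"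

lemma bij_unzip3: "bij unzip3"
proof (rule o_bij)
  let ?z = "\<lambda>(u, x, y) i. (u i, x i, y i)"
  show "?z \<circ> unzip3 = id"
    by (auto simp: fun_eq_iff unzip3_def)
  show "unzip3 \<circ> ?z = id"
    by (auto simp: fun_eq_iff unzip3_def)
qed

definition AddDelay :: "('u \<times> 'x, 'u \<times> 'y) trans \<Rightarrow>
    (('u \<times> 'x \<times> 'y) trace, ('u \<times> 'x \<times> 'y) trace) trans"
  where "AddDelay S =
    assign (\<lambda>t. case unzip3 t of (u, x, y) \<Rightarrow> ((u 0, x 0), (u 0, x))) ;;
    (S \<otimes> Skip) ;;
    demonic (\<lambda>((a, b), (u, x)) t'. case unzip3 t' of (u', x', y') \<Rightarrow>
      u' 0 = u \<and> u' 1 = a \<and> y' 0 = b \<and> x' = x)"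

text \<open>In the first update of \<open>DelayFeedback\<close> the input trace is passed on unchanged, whereas
  the state trace (apart from its first value) and the output trace are chosen demonically.\<close>
definition DelayFeedback ::
  "'u pred \<Rightarrow> ('u \<times> 'x, 'u \<times> 'y) trans \<Rightarrow> ('x trace, 'y trace) trans"
  where "DelayFeedback init S =
    demonic (\<lambda>x t. case unzip3 t of (u, x', y) \<Rightarrow> x' = x \<and> init (u 0)) ;;
    IterateNextOmega (AddDelay S) ;;
    assign (\<lambda>t. case unzip3 t of (u, x, y) \<Rightarrow> y)"

end

theory Submission
  imports Defs
begin

text \<open>All constructions are monotone in their component transformers for refinement, where serial
  composition requires its first component to be a monotonic transformer. The constructions are also
  monotonic transformers themselves, so this requirement is met in every prefix of the iteration.\<close>

lemma mono_serial:
  assumes "mono S" "mono T"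
  shows "mono (S ;; T)"
  using assms by (simp add: serial_def mono_def)

lemma mono_Skip: "mono Skip"
  by (simp add: mono_def Skip_def)

lemma mono_demonic: "mono (demonic r)"
  by (auto simp: mono_def demonic_def le_fun_def)

lemma mono_assign: "mono (assign e)"
  by (simp add: assign_def mono_demonic)

text \<open>\<open>q\<close> enters only as an upper bound on the rectangle of \<open>p\<close> and
  \<open>r\<close>, so witnesses for \<open>q\<close> also serve any larger
  \<open>q'\<close>.\<close>

lemma mono_Prod: "mono (S \<otimes> T)"
proof (intro monoI predicate1I)
  fix q q' :: "('a \<times> 'b) pred" and x
  assume "q \<le> q'" and "(S \<otimes> T) q x"
  moreover from this obtain p r where
    "\<forall>a b. p a \<and> r b \<longrightarrow> q (a, b)" "S p (fst x)" "T r (snd x)"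
    by (auto simp: Prod_def split_beta)
  ultimately have "\<forall>a b. p a \<and> r b \<longrightarrow> q' (a, b)" "S p (fst x)" "T r (snd x)"
    by auto
  then show "(S \<otimes> T) q' x"
    unfolding Prod_def split_beta by blast
qed

lemma mono_Fusion: "mono (Fusion S)"
proof (intro monoI predicate1I)
  fix q q' s
  assume "q \<le> q'" and "Fusion S q s"
  then show "Fusion S q' s"
    unfolding Fusion_def by (meson order_trans)
qed

lemma refines_refl: "S \<sqsubseteq> S"
  by (simp add: refines_def)

text \<open>Two steps: \<open>S (T q) \<le> S (T' q)\<close> by monotonicity of \<open>S\<close>,
  then \<open>S (T' q) \<le> S' (T' q)\<close> by refinement at the predicate
  \<open>T' q\<close>.\<close>

lemma refines_serial:
  assumes "mono S" "S \<sqsubseteq> S'" "T \<sqsubseteq> T'"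
  shows "S ;; T \<sqsubseteq> S' ;; T'"
  using assms unfolding refines_def serial_def mono_def by (meson order_trans)

lemma refines_Prod:
  assumes "S \<sqsubseteq> S'" "T \<sqsubseteq> T'"
  shows "S \<otimes> T \<sqsubseteq> S' \<otimes> T'"
  unfolding refines_def
proof (intro allI predicate1I)
  fix q x
  assume "(S \<otimes> T) q x"
  then obtain p r where pr: "\<forall>a b. p a \<and> r b \<longrightarrow> q (a, b)" and "S p (fst x)" "T r (snd x)"
    by (auto simp: Prod_def split_beta)
  moreover have "S p \<le> S' p" "T r \<le> T' r"
    using assms by (simp_all add: refines_def)
  ultimately have "S' p (fst x)" "T' r (snd x)"
    by auto
  with pr show "(S' \<otimes> T') q x"
    unfolding Prod_def split_beta by blast
qed

text \<open>The family \<open>p\<close> that witnesses the fusion of \<open>S\<close> also witnesses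
  that of \<open>S'\<close>, since its bound by \<open>q\<close> does not mention the
  transformers.\<close>

lemma refines_Fusion:
  assumes "\<And>i. S i \<sqsubseteq> S' i"
  shows "Fusion S \<sqsubseteq> Fusion S'"
  unfolding refines_def
proof (intro allI predicate1I)
  fix q s
  assume "Fusion S q s"
  then obtain p where "(INF i. p i) \<le> q" "\<forall>i. S i (p i) s"
    by (auto simp: Fusion_def)
  moreover have "S i (p i) \<le> S' i (p i)" for i
    using assms by (simp add: refines_def)
  ultimately show "Fusion S' q s"
    unfolding Fusion_def by (metis predicate1D)
qed

lemma mono_SkipNext: "mono (SkipNext S)"
  unfolding SkipNext_def by (intro mono_serial mono_assign mono_Prod)

lemma refines_SkipNext:
  assumes "S \<sqsubseteq> S'"
  shows "SkipNext S \<sqsubseteq> SkipNext S'"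
  unfolding SkipNext_def
  by (intro refines_serial mono_serial mono_assign mono_Prod refines_Prod refines_refl assms)

lemma mono_funpow_SkipNext:
  assumes "mono S"
  shows "mono ((SkipNext ^^ n) S)"
  \<comment> \<open>For \<open>n = 0\<close> this is \<open>S\<close> itself; otherwise the
    outermost application of \<open>SkipNext\<close> gives monotonicity.\<close>
  by (cases n) (simp_all add: assms mono_SkipNext)

lemma refines_funpow_SkipNext:
  assumes "S \<sqsubseteq> S'"
  shows "(SkipNext ^^ n) S \<sqsubseteq> (SkipNext ^^ n) S'"
  by (induction n) (simp_all add: assms refines_SkipNext)

text \<open>The prefix is the first component both when the next factor is appended and when
  \<open>SkipTop n\<close> follows, so \<open>refines_serial\<close> needs it monotone.\<close>

lemma mono_Iterate_SkipNext:
  assumes "mono S"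
  shows "mono (Iterate SkipNext S n)"
  by (induction n) (simp_all add: assms mono_Skip mono_serial mono_funpow_SkipNext)

lemma refines_Iterate_SkipNext:
  assumes "mono S" "S \<sqsubseteq> S'"
  shows "Iterate SkipNext S n \<sqsubseteq> Iterate SkipNext S' n"
  by (induction n)
    (simp_all add: assms refines_refl refines_serial mono_Iterate_SkipNext refines_funpow_SkipNext)

lemma refines_IterateNextOmega:
  assumes "mono S" "S \<sqsubseteq> S'"
  shows "IterateNextOmega S \<sqsubseteq> IterateNextOmega S'"
  unfolding IterateNextOmega_def
  by (intro refines_Fusion refines_serial mono_Iterate_SkipNext refines_Iterate_SkipNext
      refines_refl assms)

text \<open>Meets the monotonicity premise of \<open>refines_IterateNextOmega\<close> for the
  iterated transformer.\<close>

lemma mono_AddDelay: "mono (AddDelay S)"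
  unfolding AddDelay_def by (intro mono_serial mono_assign mono_Prod mono_demonic)

lemma refines_AddDelay:
  assumes "S \<sqsubseteq> S'"
  shows "AddDelay S \<sqsubseteq> AddDelay S'"
  unfolding AddDelay_def
  by (intro refines_serial mono_serial mono_assign mono_Prod refines_Prod refines_refl assms)

lemma refines_DelayFeedback:
  assumes "S \<sqsubseteq> S'"
  shows "DelayFeedback init S \<sqsubseteq> DelayFeedback init S'"
  unfolding DelayFeedback_def
\<comment> \<open>As \<open>;;\<close> associates to the left, the first component of the outer
  composition contains the iteration, which must therefore be monotone.\<close>
proof (intro refines_serial mono_serial mono_demonic refines_refl)
  show "mono (IterateNextOmega (AddDelay S))"
    by (simp add: IterateNextOmega_def mono_Fusion)
  show "IterateNextOmega (AddDelay S) \<sqsubseteq> IterateNextOmega (AddDelay S')"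
    by (intro refines_IterateNextOmega mono_AddDelay refines_AddDelay assms)
qed

theorem theorem14:
  fixes S S' :: "('u \<times> 'x, 'u \<times> 'y) trans"
    and init :: "'u pred"
  assumes "mono S" and "mono S'"
  shows "(S \<sqsubseteq> S' \<longrightarrow> AddDelay S \<sqsubseteq> AddDelay S') \<and>
         (S \<sqsubseteq> S' \<longrightarrow> DelayFeedback init S \<sqsubseteq> DelayFeedback init S')"
  by (simp add: refines_AddDelay refines_DelayFeedback)

end
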